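(* Let $\mathbb{M}$ be a strongly regular sequence which admits a nonzero proximate order $\rho(t)\to\rho>0$, let $e,E$ be the associated pair of kernel functions for $\mathbb{M}$-summability, and let $m=(m(p))_{p\ge0}$ be the associated sequence of moments. Let $n\ge1$, let $A\in\mathbb{C}^{n\times n}$ be a diagonalizable matrix, and consider the Cauchy problem $\partial_m y=Ay$, $y(z_0)=y_0$, for some Cauchy data $(z_0,y_0)\in\mathbb{C}^{1+n}$. Then the solution $y=(y_1,\ldots,y_n)$ of this problem satisfies, for every $1\le h\le n$, $$h_{y_h}(\theta)\le\max\left\{|\lambda|^{\rho}\,h_E(\theta+\arg(\lambda)):\lambda\in\mathrm{spec}(A)\right\},\qquad\text{for every }\theta\in\mathbb{R}.$$
   Context: Strongly regular sequence: a sequence $\mathbb{M}=(M_p)_{p\ge0}$ of positive reals with $M_0=1$ such that (lc) $M_p^2\le M_{p-1}M_{p+1}$ for $p\ge1$; (mg) there is $A_1>0$ with $M_{p+q}\le A_1^{p+q}M_pM_q$ for all $p,q\ge0$; (snq) there is $A_2>0$ with $\sum_{q\ge p}\frac{M_q}{(q+1)M_{q+1}}\le A_2\frac{M_p}{M_{p+1}}$ for all $p\ge0$. Put $M(0)=0$, $M(t)=\sup_{p\ge0}\log(t^p/M_p)$ for $t>0$, $\rho(M)=\limsup_{r\to\infty}\max\{0,\log M(r)/\log r\}$, and $\omega(\mathbb{M})=1/\rho(M)$. Nonzero proximate order: a nonnegative $C^1$ function $\rho(t)$ on some $(c,\infty)$ with $\lim_{r\to\infty}\rho(r)=\rho>0$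 and $\lim_{r\to\infty}r\rho'(r)\ln r=0$. The sequence $\mathbb{M}$ admits the nonzero proximate order $\rho(t)$ if $\log(t)\left(\rho(t)-\frac{\log M(t)}{\log t}\right)$ is bounded for $t$ large. Sectors: $S_d(\theta)=\{z:|\arg(z)-d|<\theta/2\}$ (on the Riemann surface of the logarithm). $D(z_0,r)$ is the open disc. Pair of kernel functions for $\mathbb{M}$-summability ($0<\omega(\mathbb{M})<2$): functions $e,E$ such that (1) $e$ is holomorphic on $S_0(\omega(\mathbb{M})\pi)$; there is $t_0>0$ such that for every $z_0\in S_0(\omega(\mathbb{M})\pi)$ there is $r_0>0$ with $D(z_0,r_0)\subseteq S_0(\omega(\mathbb{M})\pi)$ and $\int_0^{t_0}\sup_{z\in D(z_0,r_0)}|e(t/z)|\frac{dt}{t}<\infty$; and for every $\delta>0$ there are $k_1,k_2>0$ with $|e(z)|\le k_1\exp(-M(|z|/k_2))$ on $S_0(\omega(\mathbb{M})\pi-\delta)$. (2) $e(|z|)\in\mathbb{R}$ for all $z\in S_0(\omega(\mathbb{M})\pi)$. (3) $E$ is entire, there are $k_3,k_4>0$ with $|E(z)|\le k_3\exp(M(|z|/k_4))$ on $\mathbb{C}$, and there is $\beta>0$ such that for all $0<\theta<2\pi-\omega(\mathbb{M})\pi$ and $R>0$ there is $k_5>0$ with $|E(z)|\le k_5|z|^{-\beta}$ for $z\in S_\pi(\theta)$, $|z|\ge R$. (4) $E(z)=\sum_{p\ge0}\frac{z^p}{m(p)}$, where $m(z)=\int_0^\infty t^{z-1}e(t)\,dt$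 for $\mathrm{Re}(z)\ge0$ is continuous there and holomorphic for $\mathrm{Re}(z)>0$. The sequence $m=(m(p))_{p\ge0}$ (of positive reals) is the sequence of moments. If $\mathbb{M}$ admits a nonzero proximate order, such a pair exists, and it is fixed. Moment derivative: $\partial_m\left(\sum_{p\ge0}\frac{a_p}{m(p)}z^p\right)=\sum_{p\ge0}\frac{a_{p+1}}{m(p)}z^p$ on $\mathbb{C}[[z]]$, extended to functions holomorphic near $0$ via Taylor expansion at $0$, and to vectors componentwise. A solution of $\partial_m y=Ay$ is a vector $y=(y_1,\ldots,y_n)^T$ of such functions satisfying the equation (such solutions are entire). Generalized indicator: for $f$ entire and a proximate order $\rho(t)$, $M_f(r)=\max_{|z|=r}|f(z)|$; $\rho(t)$ is a proximate order of $f$ if $0<\limsup_{r\to\infty}\frac{\ln M_f(r)}{r^{\rho(r)}}<\infty$. The generalized indicator of $f$ (relative to $\rho(t)$) is $h_f(\theta)=\limsup_{r\to\infty}\frac{\ln|f(re^{i\theta})|}{r^{\rho(r)}}$, $\theta\in\mathbb{R}$ (with $\ln 0=-\infty$). The given $\rho(t)$ is a proximate order of the kernel $E$, and $h_E$ is taken relative to it. The indicator $h_{y_h}$ is taken relative to $t\mapsto\rho(|\lambda_0|t)$, where $\lambda_0$ is an eigenvalue of $A$ of largest modulus (relative to $\rho(t)$ itself if $A=0$). For $\lambda=0\in\mathrm{spec}(A)$ the quantity $|\lambda|^{\rho}h_E(\theta+\arg\lambda)$ is understood to be $0$. *)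

theory Defs
  imports "HOL-Complex_Analysis.Complex_Analysis"
begin

definition strongly_regular :: "(nat \<Rightarrow> real) \<Rightarrow> bool" where
  "strongly_regular M \<longleftrightarrow>
     M 0 = 1 \<and> (\<forall>p. 0 < M p) \<and>
     (\<forall>p\<ge>1. (M p)\<^sup>2 \<le> M (p - 1) * M (p + 1)) \<and>
     (\<exists>A1>0. \<forall>p q. M (p + q) \<le> A1 ^ (p + q) * M p * M q) \<and>
     summable (\<lambda>q. M q / (real (q + 1) * M (q + 1))) \<and>
     (\<exists>A2>0. \<forall>p. (\<Sum>k. M (p + k) / (real (p + k + 1) * M (p + k + 1)))
                    \<le> A2 * (M p / M (p + 1)))"

text \<open>For a strongly regular sequence the supremum below is finite, since
  \<open>M (p + 1) / M p\<close> tends to infinity.\<close>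

definition assoc_fun :: "(nat \<Rightarrow> real) \<Rightarrow> real \<Rightarrow> real" where
  "assoc_fun M t = (if t \<le> 0 then 0 else (SUP p. ln (t ^ p / M p)))"

definition growth_order :: "(nat \<Rightarrow> real) \<Rightarrow> ereal" where
  "growth_order M = Limsup at_top (\<lambda>r. ereal (max 0 (ln (assoc_fun M r) / ln r)))"

definition growth_index :: "(nat \<Rightarrow> real) \<Rightarrow> ereal" where
  "growth_index M = 1 / growth_order M"

text \<open>A proximate order is only given on some \<open>(c, \<infinity>)\<close>; its values elsewhere are arbitrary
  and never matter, since it is only used near infinity.\<close>

definition nonzero_proximate_order :: "(real \<Rightarrow> real) \<Rightarrow> real \<Rightarrow> bool" where
  "nonzero_proximate_order rho \<rho> \<longleftrightarrow>
     (\<exists>c. rho C1_differentiable_on {c<..} \<and> (\<forall>t>c. 0 \<le> rho t)) \<and>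
     (rho \<longlongrightarrow> \<rho>) at_top \<and> 0 < \<rho> \<and>
     ((\<lambda>r. r * deriv rho r * ln r) \<longlongrightarrow> 0) at_top"

definition admits_proximate_order :: "(nat \<Rightarrow> real) \<Rightarrow> (real \<Rightarrow> real) \<Rightarrow> bool" where
  "admits_proximate_order M rho \<longleftrightarrow>
     (\<exists>B. \<forall>\<^sub>F t in at_top. \<bar>ln t * (rho t - ln (assoc_fun M t) / ln t)\<bar> \<le> B)"

text \<open>The projection to the complex plane of the sector with bisecting direction \<open>d\<close> and
  opening \<open>\<theta>\<close> on the Riemann surface of the logarithm. It is used only for openings less
  than \<open>2 * pi\<close>, where the projection is injective.\<close>

definition sector :: "real \<Rightarrow> real \<Rightarrow> complex set" where
  "sector d \<theta> = {rcis r \<phi> | r \<phi>. 0 < r \<and> \<bar>\<phi> - d\<bar> < \<theta> / 2}"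

definition moment_fun :: "(complex \<Rightarrow> complex) \<Rightarrow> complex \<Rightarrow> complex" where
  "moment_fun e z = (LINT t:{0<..}|lborel. of_real t powr (z - 1) * e (of_real t))"

definition moments :: "(complex \<Rightarrow> complex) \<Rightarrow> nat \<Rightarrow> real" where
  "moments e p = Re (moment_fun e (of_nat p))"

text \<open>Positivity of the moments has to be required: the pair \<open>(- e, - E)\<close> shares all the
  other properties with \<open>(e, E)\<close>. The integral over \<open>(0, t0)\<close> is taken with values in
  \<open>[0, \<infinity>]\<close>, so that its finiteness is not obscured by a default value.\<close>

definition kernel_pair ::
    "(nat \<Rightarrow> real) \<Rightarrow> (complex \<Rightarrow> complex) \<Rightarrow> (complex \<Rightarrow> complex) \<Rightarrow> bool" where
  "kernel_pair M e E \<longleftrightarrow>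
     0 < growth_index M \<and> growth_index M < 2 \<and>
     (let \<alpha> = real_of_ereal (growth_index M) * pi; S = sector 0 \<alpha> in
       e holomorphic_on S \<and>
       (\<exists>t0>0. \<forall>z0\<in>S. \<exists>r0>0. ball z0 r0 \<subseteq> S \<and>
          (\<integral>\<^sup>+t\<in>{0<..<t0}. (SUP z\<in>ball z0 r0. ennreal (cmod (e (of_real t / z)))) / ennreal t
             \<partial>lborel) < \<infinity>) \<and>
       (\<forall>\<delta>>0. \<exists>k1>0. \<exists>k2>0. \<forall>z\<in>sector 0 (\<alpha> - \<delta>).
          cmod (e z) \<le> k1 * exp (- assoc_fun M (cmod z / k2))) \<and>
       (\<forall>z\<in>S. e (of_real (cmod z)) \<in> \<real>) \<and>
       E holomorphic_on UNIV \<and>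
       (\<exists>k3>0. \<exists>k4>0. \<forall>z. cmod (E z) \<le> k3 * exp (assoc_fun M (cmod z / k4))) \<and>
       (\<exists>\<beta>>0. \<forall>\<theta>. 0 < \<theta> \<and> \<theta> < 2 * pi - \<alpha> \<longrightarrow>
          (\<forall>R>0. \<exists>k5>0. \<forall>z\<in>sector pi \<theta>. R \<le> cmod z \<longrightarrow>
             cmod (E z) \<le> k5 * cmod z powr (- \<beta>))) \<and>
       continuous_on {z. 0 \<le> Re z} (moment_fun e) \<and>
       moment_fun e holomorphic_on {z. 0 < Re z} \<and>
       (\<forall>p. moment_fun e (of_nat p) \<in> \<real> \<and> 0 < moments e p) \<and>
       (\<forall>z. (\<lambda>p. z ^ p / moment_fun e (of_nat p)) sums E z))"

text \<open>Moment derivative on formal power series. The coefficients \<open>F\<^sub>p = a\<^sub>p / m p\<close> are sent to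
  \<open>a\<^sub>p\<^sub>+\<^sub>1 / m p\<close>, where \<open>a\<^sub>p\<^sub>+\<^sub>1 = m (p + 1) * F\<^sub>p\<^sub>+\<^sub>1\<close>.\<close>

definition fps_moment_deriv :: "(nat \<Rightarrow> real) \<Rightarrow> complex fps \<Rightarrow> complex fps" where
  "fps_moment_deriv m F = Abs_fps (\<lambda>p. of_real (m (p + 1)) * fps_nth F (p + 1) / of_real (m p))"

text \<open>\<open>f\<close> and \<open>g\<close> are holomorphic near \<open>0\<close>, and \<open>g\<close> is the moment derivative of \<open>f\<close> there.\<close>

definition has_moment_deriv ::
    "(nat \<Rightarrow> real) \<Rightarrow> (complex \<Rightarrow> complex) \<Rightarrow> (complex \<Rightarrow> complex) \<Rightarrow> bool" where
  "has_moment_deriv m f g \<longleftrightarrow>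
     (\<exists>F. f has_fps_expansion F \<and> g has_fps_expansion fps_moment_deriv m F)"

definition moment_solution ::
    "(nat \<Rightarrow> real) \<Rightarrow> complex^'n^'n \<Rightarrow> (complex \<Rightarrow> complex^'n) \<Rightarrow> bool" where
  "moment_solution m A y \<longleftrightarrow> (\<forall>i. has_moment_deriv m (\<lambda>z. y z $ i) (\<lambda>z. (A *v y z) $ i))"

definition spec :: "complex^'n^'n \<Rightarrow> complex set" where
  "spec A = {\<mu>. \<exists>v. v \<noteq> 0 \<and> A *v v = \<mu> *s v}"

definition diagonalizable :: "complex^'n^'n \<Rightarrow> bool" where
  "diagonalizable A \<longleftrightarrow>
     (\<exists>P D :: complex^'n^'n. invertible P \<and> (\<forall>i j. i \<noteq> j \<longrightarrow> D $ i $ j = 0) \<and> A = P ** D ** matrix_inv P)"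

text \<open>The logarithm on \<open>[0, \<infinity>)\<close> with \<open>ln 0 = - \<infinity>\<close> (the library has \<open>ln 0 = 0\<close> on the reals).\<close>

definition eln :: "real \<Rightarrow> ereal" where
  "eln x = (if x = 0 then - \<infinity> else ereal (ln x))"

definition gen_indicator :: "(real \<Rightarrow> real) \<Rightarrow> (complex \<Rightarrow> complex) \<Rightarrow> real \<Rightarrow> ereal" where
  "gen_indicator rho f \<theta> =
     Limsup at_top (\<lambda>r. eln (cmod (f (rcis r \<theta>))) / ereal (r powr rho r))"

text \<open>Every solution near \<open>0\<close> is the restriction of an entire one, so that nothing is lost by
  considering entire solutions only.\<close>

lemma moment_solution_entire_extension:
  fixes y :: "complex \<Rightarrow> complex^'n"
  assumes "kernel_pair M e E" and "moment_solution (moments e) A y"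
  shows "\<exists>Y. moment_solution (moments e) A Y \<and> (\<forall>i. (\<lambda>z. Y z $ i) holomorphic_on UNIV) \<and>
             (\<forall>\<^sub>F z in nhds 0. Y z = y z)"
proof -
  define m where "m = moments e"
  have pos: "m p > 0" for p
    using assms(1) by (auto simp: kernel_pair_def Let_def m_def)
  have mf: "moment_fun e (of_nat p) = of_real (m p)" for p
    using assms(1) by (auto simp: kernel_pair_def Let_def m_def moments_def complex_is_Real_iff complex_eq_iff)
  have summ: "summable (\<lambda>p. z ^ p / of_real (m p) :: complex)" for z
  proof -
    have "(\<lambda>p. z ^ p / moment_fun e (of_nat p)) sums E z"
      using assms(1) unfolding kernel_pair_def Let_def by blast
    then show ?thesis unfolding mf by (rule sums_summable)
  qed
  have "\<forall>i. \<exists>F. (\<lambda>z. y z $ i) has_fps_expansion F \<and>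
      (\<lambda>z. (A *v y z) $ i) has_fps_expansion fps_moment_deriv m F"
    using assms(2) by (simp add: moment_solution_def has_moment_deriv_def m_def)
  then obtain F where F: "\<And>i. (\<lambda>z. y z $ i) has_fps_expansion F i"
      and dF: "\<And>i. (\<lambda>z. (A *v y z) $ i) has_fps_expansion fps_moment_deriv m (F i)"
    by metis
  have AF: "(\<lambda>z. (A *v y z) $ i) has_fps_expansion (\<Sum>j\<in>UNIV. fps_const (A $ i $ j) * F j)" for i
    unfolding matrix_vector_mult_def
    by (simp, intro has_fps_expansion_sum has_fps_expansion_cmult_left F)
  have eq: "fps_moment_deriv m (F i) = (\<Sum>j\<in>UNIV. fps_const (A $ i $ j) * F j)" for i
    using fps_nth_fps_expansion[OF dF[of i]] fps_nth_fps_expansion[OF AF[of i]]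
    by (simp add: fps_eq_iff)
  define c where "c p i = of_real (m p) * fps_nth (F i) p" for p i
  have rec: "c (Suc p) i = (\<Sum>j\<in>UNIV. A $ i $ j * c p j)" for p i
  proof -
    have "fps_nth (fps_moment_deriv m (F i)) p = (\<Sum>j\<in>UNIV. A $ i $ j * fps_nth (F j) p)"
      by (simp add: eq fps_sum_nth)
    then have "c (Suc p) i = of_real (m p) * (\<Sum>j\<in>UNIV. A $ i $ j * fps_nth (F j) p)"
      using pos[of p] by (simp add: fps_moment_deriv_def c_def field_simps)
    also have "\<dots> = (\<Sum>j\<in>UNIV. A $ i $ j * c p j)"
      by (simp add: c_def sum_distrib_left mult_ac)
    finally show ?thesis .
  qed
  define K where "K = (\<Sum>i\<in>UNIV. \<Sum>j\<in>UNIV. cmod (A $ i $ j))"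
  define C where "C = (\<Sum>i\<in>UNIV. cmod (c 0 i))"
  have K0: "K \<ge> 0" unfolding K_def by (intro sum_nonneg) auto
  have C0: "C \<ge> 0" unfolding C_def by (intro sum_nonneg) auto
  have bound: "cmod (c p i) \<le> K ^ p * C" for p i
  proof (induction p arbitrary: i)
    case 0
    have "cmod (c 0 i) \<le> C" unfolding C_def by (rule member_le_sum) auto
    then show ?case by simp
  next
    case (Suc p)
    have "cmod (c (Suc p) i) \<le> (\<Sum>j\<in>UNIV. cmod (A $ i $ j * c p j))"
      unfolding rec by (rule norm_sum)
    also have "\<dots> \<le> (\<Sum>j\<in>UNIV. cmod (A $ i $ j) * (K ^ p * C))"
      by (intro sum_mono) (simp add: norm_mult mult_left_mono Suc.IH)
    also have "\<dots> = (\<Sum>j\<in>UNIV. cmod (A $ i $ j)) * (K ^ p * C)"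
      by (simp add: sum_distrib_right)
    also have "\<dots> \<le> K * (K ^ p * C)"
    proof (rule mult_right_mono)
      show "(\<Sum>j\<in>UNIV. cmod (A $ i $ j)) \<le> K"
        unfolding K_def
        by (rule member_le_sum[where f = "\<lambda>i. \<Sum>j\<in>UNIV. cmod (A $ i $ j)"]) (auto intro: sum_nonneg)
    qed (use K0 C0 in auto)
    finally show ?case by (simp add: mult_ac)
  qed
  have rad: "fps_conv_radius (F i) = \<infinity>" for i
    unfolding fps_conv_radius_def
  proof (rule conv_radius_inftyI'')
    fix z :: complex
    have "summable (\<lambda>p. C * ((K * cmod z) ^ p / m p))"
    proof (rule summable_mult)
      have "summable (\<lambda>p. of_real ((K * cmod z) ^ p / m p) :: complex)"
        using summ[of "of_real (K * cmod z)"] by simp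
      then show "summable (\<lambda>p. (K * cmod z) ^ p / m p)"
        by (subst (asm) summable_of_real_iff)
    qed
    moreover have "cmod (fps_nth (F i) p * z ^ p) \<le> C * ((K * cmod z) ^ p / m p)" for p
    proof -
      have "fps_nth (F i) p = c p i / of_real (m p)"
        using pos[of p] by (simp add: c_def)
      then have "cmod (fps_nth (F i) p * z ^ p) = cmod (c p i) * (cmod z ^ p / m p)"
        using pos[of p] by (simp add: norm_mult norm_divide norm_power)
      also have "\<dots> \<le> (K ^ p * C) * (cmod z ^ p / m p)"
        using pos[of p] by (intro mult_right_mono bound) auto
      finally show ?thesis by (simp add: power_mult_distrib mult_ac)
    qed
    ultimately show "summable (\<lambda>p. fps_nth (F i) p * z ^ p)"
      by (rule summable_comparison_test'[where N = 0])
  qed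
  define Y where "Y z = (\<chi> i. eval_fps (F i) z)" for z
  have ev: "\<forall>\<^sub>F z in nhds 0. Y z = y z"
  proof -
    have "\<forall>\<^sub>F z in nhds 0. \<forall>i. eval_fps (F i) z = y z $ i"
      using F by (intro eventually_all_finite) (auto simp: has_fps_expansion_def)
    then show ?thesis
      by eventually_elim (auto simp: Y_def vec_eq_iff)
  qed
  have "(\<lambda>z. Y z $ i) holomorphic_on UNIV" for i
    using holomorphic_on_eval_fps[of UNIV "F i"] by (simp add: Y_def rad eball_inf)
  moreover have "moment_solution m A Y"
    unfolding moment_solution_def has_moment_deriv_def
  proof (intro allI exI conjI)
    fix i
    show "(\<lambda>z. Y z $ i) has_fps_expansion F i"
      by (simp add: Y_def has_fps_expansion_def rad)
    have "\<forall>\<^sub>F z in nhds 0. (A *v y z) $ i = (A *v Y z) $ i"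
      using ev by eventually_elim simp
    then show "(\<lambda>z. (A *v Y z) $ i) has_fps_expansion fps_moment_deriv m (F i)"
      using dF[of i] unfolding has_fps_expansion_def
      by (auto elim: eventually_elim2)
  qed
  ultimately show ?thesis using ev unfolding m_def by blast
qed

end

theory Submission
  imports Defs
begin

text \<open>
  Diagonalizing \<open>A\<close> decouples the system: in a basis of eigenvectors the moment Taylor coefficients
  of \<open>y\<close> are geometric sequences \<open>d\<^sub>j ^ p\<close>, and \<open>\<Sum>p. (d\<^sub>j * z) ^ p / m p = E (d\<^sub>j * z)\<close>. Hence each
  component of \<open>y\<close> is a fixed linear combination of the functions \<open>z \<mapsto> E (d\<^sub>j * z)\<close>, where the
  \<open>d\<^sub>j\<close> run through the eigenvalues (\<open>diagonalizable_solution_kernel_sum\<close>).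

  On the ray of direction \<open>\<theta>\<close>, \<open>E (\<mu> * z)\<close> is \<open>E\<close> at radius \<open>\<bar>\<mu>\<bar> * r\<close> in direction
  \<open>\<theta> + Arg \<mu>\<close>. So its growth is naturally measured by \<open>V (\<bar>\<mu>\<bar> * r)\<close> with \<open>V r = r powr rho r\<close>,
  whereas the indicator of \<open>y\<close> measures it by \<open>W r = r powr rho (s * r)\<close> with \<open>s\<close> the spectral
  radius (or \<open>s = 1\<close> if \<open>A = 0\<close>).
  The condition \<open>r * rho' r * ln r \<longlonglongrightarrow> 0\<close> on a proximate order makes \<open>rho (k * r) - rho r\<close>
  be of order \<open>o (1 / ln r)\<close>, and this gives \<open>V (\<bar>\<mu>\<bar> * r) / W r \<longlonglongrightarrow> \<bar>\<mu>\<bar> powr \<rho>\<close>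
  (\<open>proximate_order_rescaled_ratio\<close>); this limit is the factor of \<open>h\<^sub>E\<close> in the theorem.

  A finite sum grows at most like its largest term, because \<open>W r \<longlonglongrightarrow> \<infinity>\<close> makes constant
  factors negligible. It is convenient to phrase all growth bounds as
  \<open>cmod (f (rcis r \<theta>)) \<le> exp (C * W r)\<close> for large \<open>r\<close>, with \<open>C\<close> an arbitrary real above the
  claimed bound: such estimates need no special treatment of zeros of \<open>f\<close> or infinite indicators.
\<close>

section \<open>Regular variation of a proximate order\<close>

lemma filterlim_mult_pos_at_top:
  assumes "0 < (k::real)"
  shows "filterlim (\<lambda>r. k * r) at_top at_top"
  using assms by (intro filterlim_tendsto_pos_mult_at_top[OF tendsto_const _ filterlim_ident])

text \<open>The mean value theorem turns the decay of \<open>r * rho' r * ln r\<close> into decay of the difference: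
  the intermediate point is comparable with \<open>r\<close>, and so is its logarithm with \<open>ln r\<close>.\<close>

lemma proximate_order_scale_diff:
  assumes npo: "nonzero_proximate_order rho \<rho>" and k: "0 < (k::real)"
  shows "((\<lambda>r. (rho (k * r) - rho r) * ln r) \<longlongrightarrow> 0) at_top"
proof (rule tendstoI)
  fix \<epsilon> :: real
  assume eps: "0 < \<epsilon>"
  obtain c where c1: "rho C1_differentiable_on {c<..}"
    using npo unfolding nonzero_proximate_order_def by blast
  have der: "(rho has_real_derivative deriv rho x) (at x)" if "c < x" for x
  proof -
    obtain D where "\<forall>x\<in>{c<..}. (rho has_vector_derivative D x) (at x)"
      using c1 unfolding C1_differentiable_on_def by blast
    then have "(rho has_real_derivative D x) (at x)"
      using that by (auto simp: has_real_derivative_iff_has_vector_derivative)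
    then show ?thesis using DERIV_imp_deriv by metis
  qed
  have mvt: "\<exists>\<xi>. min u v \<le> \<xi> \<and> rho v - rho u = deriv rho \<xi> * (v - u)"
    if uv: "c < u" "c < v" for u v
  proof (cases u v rule: linorder_cases)
    case less
    then obtain \<xi> where "u < \<xi>" "rho v - rho u = (v - u) * deriv rho \<xi>"
      using MVT2[of u v rho "deriv rho"] der less_le_trans[OF uv(1)] by blast
    then show ?thesis using less by (intro exI[of _ \<xi>]) auto
  next
    case greater
    then obtain \<xi> where "v < \<xi>" "rho u - rho v = (u - v) * deriv rho \<xi>"
      using MVT2[of v u rho "deriv rho"] der less_le_trans[OF uv(2)] by blast
    then show ?thesis using greater by (intro exI[of _ \<xi>]) (auto simp: algebra_simps)
  qed auto
  define a where "a = min 1 k"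
  have a: "0 < a" "a \<le> 1" "a \<le> k" using k by (auto simp: a_def)
  \<comment> \<open>Since \<open>\<xi> * ln \<xi> \<ge> a * r * ln r / 2\<close> below, this is the decay that yields \<open>\<epsilon>\<close>; the
      summand \<open>1\<close> covers the case \<open>k = 1\<close>.\<close>
  define \<eta> where "\<eta> = \<epsilon> * a / (2 * (\<bar>k - 1\<bar> + 1))"
  have eta: "0 < \<eta>"
    unfolding \<eta>_def using eps a by (intro divide_pos_pos mult_pos_pos) linarith+
  have "((\<lambda>r. r * deriv rho r * ln r) \<longlongrightarrow> 0) at_top"
    using npo unfolding nonzero_proximate_order_def by blast
  from tendstoD[OF this eta] obtain X where X: "\<And>x. X \<le> x \<Longrightarrow> \<bar>x * deriv rho x * ln x\<bar> < \<eta>"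
    by (auto simp: eventually_at_top_linorder)
  have "\<forall>\<^sub>F r in at_top. max X (c + 1) \<le> a * r"
    using filterlim_mult_pos_at_top[OF a(1)] unfolding filterlim_at_top by blast
  moreover have "\<forall>\<^sub>F r in at_top. - 2 * ln a \<le> ln r"
    using ln_at_top unfolding filterlim_at_top by blast
  ultimately show "\<forall>\<^sub>F r in at_top. dist ((rho (k * r) - rho r) * ln r) 0 < \<epsilon>"
    using eventually_gt_at_top[of 1]
  proof eventually_elim
    case (elim r)
    have r: "1 < r" "0 < ln r" using elim by auto
    have "a * r \<le> 1 * r" "a * r \<le> k * r" using a r by (intro mult_right_mono; simp)+
    moreover have "c + 1 \<le> a * r" using elim by simp
    ultimately have "c < r" "c < k * r" and min: "a * r \<le> min r (k * r)" by linarith+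
    then obtain \<xi> where xi: "min r (k * r) \<le> \<xi>"
        "rho (k * r) - rho r = deriv rho \<xi> * (k * r - r)"
      using mvt by blast
    have xi_ge: "a * r \<le> \<xi>" using min xi by linarith
    have ar0: "0 < a * r" using a r by simp
    have "ln r / 2 \<le> ln (a * r)" using a r elim by (simp add: ln_mult)
    also have "\<dots> \<le> ln \<xi>" using xi_ge ar0 by (intro ln_mono) auto
    finally have lnxi: "ln r / 2 \<le> ln \<xi>" .
    have "\<bar>deriv rho \<xi>\<bar> * (a * r * (ln r / 2)) \<le> \<bar>deriv rho \<xi>\<bar> * (\<xi> * ln \<xi>)"
      using xi_ge ar0 lnxi r by (intro mult_left_mono mult_mono) auto
    also have "\<dots> = \<bar>\<xi> * deriv rho \<xi> * ln \<xi>\<bar>"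
    proof -
      have "0 \<le> \<xi>" "0 \<le> ln \<xi>" using xi_ge ar0 lnxi r by linarith+
      then show ?thesis by (simp add: abs_mult)
    qed
    also have "\<dots> < \<eta>" using X[of \<xi>] xi_ge elim by simp
    finally have b: "\<bar>deriv rho \<xi>\<bar> * r * ln r * a / 2 < \<eta>" by (simp add: mult_ac)
    have "\<bar>(rho (k * r) - rho r) * ln r\<bar> = \<bar>deriv rho \<xi> * (k - 1) * r * ln r\<bar>"
      unfolding xi(2) by (simp add: algebra_simps)
    also have "\<dots> = (\<bar>deriv rho \<xi>\<bar> * r * ln r) * \<bar>k - 1\<bar>"
      using r by (simp add: abs_mult)
    also have "\<dots> \<le> (\<bar>deriv rho \<xi>\<bar> * r * ln r) * (\<bar>k - 1\<bar> + 1)"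
      using r by (intro mult_left_mono) auto
    also have "\<dots> < (2 * \<eta> / a) * (\<bar>k - 1\<bar> + 1)"
      using b a by (intro mult_strict_right_mono) (auto simp: field_simps)
    also have "\<dots> = \<epsilon>"
    proof -
      have "2 * (\<epsilon> * a / (2 * q)) / a * q = \<epsilon>" if "q \<noteq> 0" for q
        using that a by simp
      from this[of "\<bar>k - 1\<bar> + 1"] show ?thesis unfolding \<eta>_def by linarith
    qed
    finally show ?case by simp
  qed
qed

lemma proximate_order_scale_tendsto:
  assumes "nonzero_proximate_order rho \<rho>" and "0 < (k::real)"
  shows "((\<lambda>r. rho (k * r)) \<longlongrightarrow> \<rho>) at_top"
proof -
  have "(rho \<longlongrightarrow> \<rho>) at_top"
    using assms unfolding nonzero_proximate_order_def by blast
  then show ?thesis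
    by (rule filterlim_compose[OF _ filterlim_mult_pos_at_top[OF assms(2)]])
qed

text \<open>In logarithmic form the ratio is \<open>rho (k * r) * ln k + (rho (k * r) - rho (s * r)) * ln r\<close>.
  Its first term tends to \<open>\<rho> * ln k\<close>, and the second one vanishes in the limit, for every \<open>s\<close>.\<close>

lemma proximate_order_rescaled_ratio:
  assumes npo: "nonzero_proximate_order rho \<rho>" and k: "0 < (k::real)" and s: "0 < s"
  shows "((\<lambda>r. (k * r) powr rho (k * r) / r powr rho (s * r)) \<longlongrightarrow> k powr \<rho>) at_top"
proof -
  have "((\<lambda>r. rho (k * r) * ln k
              + ((rho (k * r) - rho r) * ln r - (rho (s * r) - rho r) * ln r))
          \<longlongrightarrow> \<rho> * ln k + (0 - 0)) at_top"
    by (intro tendsto_intros proximate_order_scale_tendsto[OF npo]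
        proximate_order_scale_diff[OF npo] k s)
  then have "((\<lambda>r. exp (rho (k * r) * ln k
              + ((rho (k * r) - rho r) * ln r - (rho (s * r) - rho r) * ln r)))
          \<longlongrightarrow> exp (\<rho> * ln k + (0 - 0))) at_top"
    by (rule tendsto_exp)
  moreover have "exp (\<rho> * ln k + (0 - 0)) = k powr \<rho>"
    using k by (simp add: powr_def)
  moreover have "\<forall>\<^sub>F r in at_top. exp (rho (k * r) * ln k
              + ((rho (k * r) - rho r) * ln r - (rho (s * r) - rho r) * ln r))
          = (k * r) powr rho (k * r) / r powr rho (s * r)"
    using eventually_gt_at_top[of 0]
  proof eventually_elim
    case (elim r)
    then show ?case
      using k by (simp add: powr_def ln_mult exp_diff[symmetric] algebra_simps)
  qed
  ultimately show ?thesis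
    using tendsto_cong by force
qed

lemma proximate_order_powr_at_top:
  assumes npo: "nonzero_proximate_order rho \<rho>" and s: "0 < (s::real)"
  shows "filterlim (\<lambda>r. r powr rho (s * r)) at_top at_top"
proof -
  have \<rho>: "0 < \<rho>" using npo unfolding nonzero_proximate_order_def by blast
  have "filterlim (\<lambda>r. rho (s * r) * ln r) at_top at_top"
    by (rule filterlim_tendsto_pos_mult_at_top[OF proximate_order_scale_tendsto[OF npo s] \<rho> ln_at_top])
  then have "filterlim (\<lambda>r. exp (rho (s * r) * ln r)) at_top at_top"
    by (rule filterlim_compose[OF exp_at_top])
  moreover have "\<forall>\<^sub>F r in at_top. exp (rho (s * r) * ln r) = r powr rho (s * r)"
    using eventually_gt_at_top[of 0] by eventually_elim (simp add: powr_def)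
  ultimately show ?thesis
    using filterlim_cong[OF refl refl] by force
qed

section \<open>The indicator as an exponential growth bound\<close>

lemma eln_le_iff: "0 \<le> x \<Longrightarrow> eln x \<le> ereal b \<longleftrightarrow> x \<le> exp b"
  using exp_le_cancel_iff[of "ln x" b] by (cases "x = 0") (auto simp: eln_def)

lemma eln_divide_le_iff:
  assumes "0 \<le> x" and "0 < v"
  shows "eln x / ereal v \<le> ereal C \<longleftrightarrow> x \<le> exp (C * v)"
proof -
  have "eln x / ereal v \<le> ereal C \<longleftrightarrow> eln x \<le> ereal (C * v)"
    using assms by (auto simp: eln_def divide_le_eq)
  then show ?thesis using eln_le_iff[OF assms(1)] by simp
qed

lemma gen_indicator_less_imp_exp_bound:
  assumes "gen_indicator rho f \<theta> < ereal C"
  shows "\<forall>\<^sub>F r in at_top. cmod (f (rcis r \<theta>)) \<le> exp (C * r powr rho r)"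
proof -
  have "\<forall>\<^sub>F r in at_top. eln (cmod (f (rcis r \<theta>))) / ereal (r powr rho r) < ereal C"
    using assms unfolding gen_indicator_def by (rule Limsup_lessD)
  then show ?thesis
    using eventually_gt_at_top[of 0]
  proof eventually_elim
    case (elim r)
    then show ?case
      using eln_divide_le_iff[of "cmod (f (rcis r \<theta>))" "r powr rho r" C] less_imp_le by force
  qed
qed

lemma exp_bound_imp_gen_indicator_le:
  assumes "\<forall>\<^sub>F r in at_top. cmod (f (rcis r \<theta>)) \<le> exp (C * r powr rho r)"
  shows "gen_indicator rho f \<theta> \<le> ereal C"
  unfolding gen_indicator_def
proof (rule Limsup_bounded)
  show "\<forall>\<^sub>F r in at_top. eln (cmod (f (rcis r \<theta>))) / ereal (r powr rho r) \<le> ereal C"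
    using assms eventually_gt_at_top[of 0]
  proof eventually_elim
    case (elim r)
    then show ?case
      using eln_divide_le_iff[of "cmod (f (rcis r \<theta>))" "r powr rho r" C] by simp
  qed
qed

lemma eventually_const_mult_exp_le:
  assumes W: "filterlim W at_top at_top" and "C < (C'::real)" and K: "0 < (K::real)"
  shows "\<forall>\<^sub>F r in at_top. K * exp (C * W r) \<le> exp (C' * W r)"
proof -
  have "\<forall>\<^sub>F r in at_top. ln K / (C' - C) \<le> W r"
    using W by (simp add: filterlim_at_top)
  then show ?thesis
  proof eventually_elim
    case (elim r)
    then have "ln K + C * W r \<le> C' * W r"
      using assms(2) by (simp add: field_simps)
    then have "exp (ln K + C * W r) \<le> exp (C' * W r)" by simp
    then show ?case using K by (simp add: exp_add)
  qed
qed

text \<open>Let \<open>V r = r powr rho r\<close> and \<open>W r = r powr rho (s * r)\<close>. The indicator of \<open>f\<close> bounds it on the rotated ray by \<open>exp (C' * V (\<bar>\<mu>\<bar> * r))\<close> for some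
  \<open>C' < C / \<bar>\<mu>\<bar> powr \<rho>\<close>. The strict inequality leaves room for the error in
  \<open>V (\<bar>\<mu>\<bar> * r) / W r \<longlonglongrightarrow> \<bar>\<mu>\<bar> powr \<rho>\<close>.\<close>

lemma rotated_scaled_exp_bound:
  assumes npo: "nonzero_proximate_order rho \<rho>" and s: "0 < s" and \<mu>: "\<mu> \<noteq> 0"
    and less: "ereal (cmod \<mu> powr \<rho>) * gen_indicator rho f (\<theta> + Arg \<mu>) < ereal C"
  shows "\<forall>\<^sub>F r in at_top. cmod (f (\<mu> * rcis r \<theta>)) \<le> exp (C * r powr rho (s * r))"
proof -
  define k where "k = cmod \<mu>"
  have k: "0 < k" using \<mu> by (simp add: k_def)
  have kp: "0 < k powr \<rho>" using k by simp
  have "gen_indicator rho f (\<theta> + Arg \<mu>) < ereal (C / k powr \<rho>)"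
    using less kp unfolding k_def[symmetric]
    by (cases "gen_indicator rho f (\<theta> + Arg \<mu>)") (auto simp: field_simps)
  then obtain C' where C': "gen_indicator rho f (\<theta> + Arg \<mu>) < ereal C'" "C' < C / k powr \<rho>"
    using ereal_dense2 by (metis less_ereal.simps(1))
  have "\<forall>\<^sub>F r in at_top. cmod (f (rcis (k * r) (\<theta> + Arg \<mu>))) \<le> exp (C' * (k * r) powr rho (k * r))"
    using gen_indicator_less_imp_exp_bound[OF C'(1)] filterlim_mult_pos_at_top[OF k]
    by (rule eventually_compose_filterlim)
  moreover have "\<forall>\<^sub>F r in at_top. C' * ((k * r) powr rho (k * r) / r powr rho (s * r)) < C"
  proof (rule order_tendstoD)
    show "((\<lambda>r. C' * ((k * r) powr rho (k * r) / r powr rho (s * r))) \<longlongrightarrow> C' * k powr \<rho>) at_top"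
      by (intro tendsto_intros proximate_order_rescaled_ratio[OF npo k s])
    show "C' * k powr \<rho> < C" using C'(2) kp by (simp add: field_simps)
  qed
  ultimately show ?thesis
    using eventually_gt_at_top[of 0]
  proof eventually_elim
    case (elim r)
    have "\<mu> * rcis r \<theta> = rcis (k * r) (\<theta> + Arg \<mu>)"
      by (metis rcis_cmod_Arg rcis_mult k_def add.commute)
    then have "cmod (f (\<mu> * rcis r \<theta>)) \<le> exp (C' * (k * r) powr rho (k * r))"
      using elim by simp
    also have "\<dots> \<le> exp (C * r powr rho (s * r))"
      using elim by (simp add: field_simps)
    finally show ?case .
  qed
qed

section \<open>Solutions as combinations of dilated kernels\<close>

lemma matrix_inv_inverse:
  assumes "invertible P"
  shows "P ** matrix_inv P = mat 1" and "matrix_inv P ** P = mat 1"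
  using someI_ex[OF assms[unfolded invertible_def]] by (auto simp: matrix_inv_def)

lemma diagonal_mult_vector_nth:
  fixes D :: "'a::comm_semiring_1^'n^'n"
  assumes "\<And>i j. i \<noteq> j \<Longrightarrow> D $ i $ j = 0"
  shows "(D *v w) $ i = D $ i $ i * w $ i"
proof -
  have "(\<Sum>j\<in>UNIV - {i}. D $ i $ j * w $ j) = 0"
    using assms by (intro sum.neutral) auto
  then show ?thesis
    by (simp add: matrix_vector_mult_def sum.remove[of UNIV i])
qed

lemma spec_diagonalized:
  fixes P D :: "complex^'n^'n"
  assumes P: "invertible P" and D: "\<And>i j. i \<noteq> j \<Longrightarrow> D $ i $ j = 0"
  shows "spec (P ** D ** matrix_inv P) = range (\<lambda>j. D $ j $ j)"
proof -
  have inv: "P ** matrix_inv P = mat 1" "matrix_inv P ** P = mat 1"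
    using matrix_inv_inverse[OF P] by simp_all
  note Dv = diagonal_mult_vector_nth[OF D]
  show ?thesis
  proof (intro equalityI subsetI)
    fix \<mu> assume "\<mu> \<in> spec (P ** D ** matrix_inv P)"
    then obtain v where v: "v \<noteq> 0" "(P ** D ** matrix_inv P) *v v = \<mu> *s v"
      unfolding spec_def by blast
    define w where "w = matrix_inv P *v v"
    have "P *v w = v" by (simp add: w_def matrix_vector_mul_assoc inv)
    then have "w \<noteq> 0" using v by auto
    then obtain i where i: "w $ i \<noteq> 0" by (auto simp: vec_eq_iff)
    have "D *v w = matrix_inv P *v ((P ** D ** matrix_inv P) *v v)"
      by (simp add: w_def matrix_vector_mul_assoc matrix_mul_assoc inv)
    also have "\<dots> = \<mu> *s w" by (simp add: v w_def vector_scalar_commute)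
    finally have "(D *v w) $ i = \<mu> * w $ i" by simp
    then show "\<mu> \<in> range (\<lambda>j. D $ j $ j)" using i Dv by auto
  next
    fix \<mu> assume "\<mu> \<in> range (\<lambda>j. D $ j $ j)"
    then obtain j where j: "\<mu> = D $ j $ j" by blast
    define v where "v = P *v axis j 1"
    have Piv: "matrix_inv P *v v = axis j 1" by (simp add: v_def matrix_vector_mul_assoc inv)
    have "(axis j 1 :: complex^'n) \<noteq> 0" by (simp add: axis_eq_0_iff)
    then have "v \<noteq> 0" using Piv by auto
    moreover have "D *v axis j 1 = \<mu> *s axis j 1"
      by (simp add: vec_eq_iff Dv j axis_def)
    then have "(P ** D ** matrix_inv P) *v v = \<mu> *s v"
      by (simp only: matrix_vector_mul_assoc[symmetric] Piv) (simp add: v_def vector_scalar_commute)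
    ultimately show "\<mu> \<in> spec (P ** D ** matrix_inv P)" unfolding spec_def by blast
  qed
qed

text \<open>The scaled Taylor coefficients \<open>m p * F p\<close> satisfy \<open>c (p + 1) = A *v c p\<close>, hence
  \<open>c p = P ** D ^ p ** P\<inverse> *v c 0\<close>. Summing the Taylor series gives the identity near \<open>0\<close>, and both
  sides are entire.\<close>

lemma diagonalizable_solution_kernel_sum:
  fixes A P D :: "complex^'n^'n" and y :: "complex \<Rightarrow> complex^'n"
  assumes pos: "\<And>p. 0 < m p" and E: "\<And>z. (\<lambda>p. z ^ p / of_real (m p)) sums E z"
    and Ehol: "E holomorphic_on UNIV"
    and P: "invertible P" and D: "\<And>i j. i \<noteq> j \<Longrightarrow> D $ i $ j = 0"
    and A: "A = P ** D ** matrix_inv P"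
    and sol: "moment_solution m A y"
    and entire: "(\<lambda>z. y z $ h) holomorphic_on UNIV"
  shows "\<exists>b. \<forall>z. y z $ h = (\<Sum>j\<in>UNIV. b j * E (D $ j $ j * z))"
proof -
  have inv: "P ** matrix_inv P = mat 1" "matrix_inv P ** P = mat 1"
    using matrix_inv_inverse[OF P] by simp_all
  obtain F where F: "\<And>i. (\<lambda>z. y z $ i) has_fps_expansion F i"
      and dF: "\<And>i. (\<lambda>z. (A *v y z) $ i) has_fps_expansion fps_moment_deriv m (F i)"
    using sol unfolding moment_solution_def has_moment_deriv_def by metis
  have AF: "(\<lambda>z. (A *v y z) $ i) has_fps_expansion (\<Sum>j\<in>UNIV. fps_const (A $ i $ j) * F j)" for i
    unfolding matrix_vector_mult_def
    by (simp, intro has_fps_expansion_sum has_fps_expansion_cmult_left F)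
  have eq: "fps_moment_deriv m (F i) = (\<Sum>j\<in>UNIV. fps_const (A $ i $ j) * F j)" for i
    using fps_nth_fps_expansion[OF dF[of i]] fps_nth_fps_expansion[OF AF[of i]]
    by (simp add: fps_eq_iff)
  define c :: "nat \<Rightarrow> complex^'n" where "c p = (\<chi> i. of_real (m p) * fps_nth (F i) p)" for p
  have rec: "c (Suc p) = A *v c p" for p
  proof -
    have "of_real (m (Suc p)) * fps_nth (F i) (Suc p)
        = (\<Sum>j\<in>UNIV. A $ i $ j * (of_real (m p) * fps_nth (F j) p))" for i
    proof -
      have "fps_nth (fps_moment_deriv m (F i)) p = (\<Sum>j\<in>UNIV. A $ i $ j * fps_nth (F j) p)"
        by (simp add: eq fps_sum_nth)
      then have "of_real (m (Suc p)) * fps_nth (F i) (Suc p)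
          = of_real (m p) * (\<Sum>j\<in>UNIV. A $ i $ j * fps_nth (F j) p)"
        using pos[of p] by (simp add: fps_moment_deriv_def field_simps)
      then show ?thesis by (simp add: sum_distrib_left mult_ac)
    qed
    then show ?thesis by (simp add: vec_eq_iff c_def matrix_vector_mult_def)
  qed
  define u where "u p = matrix_inv P *v c p" for p
  have c_u: "c p = P *v u p" for p
    by (simp add: u_def matrix_vector_mul_assoc inv)
  have u_rec: "u (Suc p) = D *v u p" for p
    by (simp add: u_def rec A matrix_vector_mul_assoc matrix_mul_assoc inv)
  have u: "u p $ j = (D $ j $ j) ^ p * u 0 $ j" for p j
  proof (induction p)
    case (Suc p)
    then show ?case using diagonal_mult_vector_nth[OF D] by (simp add: u_rec mult_ac)
  qed simp
  define b where "b j = P $ h $ j * u 0 $ j" for j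
  define G where "G z = (\<Sum>j\<in>UNIV. b j * E (D $ j $ j * z))" for z
  have Ghol: "G holomorphic_on UNIV"
    unfolding G_def
    by (intro holomorphic_intros holomorphic_on_compose[of _ UNIV E, unfolded o_def]
        holomorphic_on_subset[OF Ehol]) auto
  have evalF: "eval_fps (F h) z = G z" for z
  proof -
    have "fps_nth (F h) p * z ^ p = (\<Sum>j\<in>UNIV. b j * ((D $ j $ j * z) ^ p / of_real (m p)))" for p
    proof -
      have "of_real (m p) * fps_nth (F h) p = c p $ h" by (simp add: c_def)
      also have "\<dots> = (\<Sum>j\<in>UNIV. b j * (D $ j $ j) ^ p)"
        by (simp add: c_u matrix_vector_mult_def u[of p] b_def mult_ac)
      finally have "fps_nth (F h) p = (\<Sum>j\<in>UNIV. b j * (D $ j $ j) ^ p) / of_real (m p)"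
        using pos[of p] by (simp add: field_simps)
      then show ?thesis
        by (simp add: sum_distrib_left sum_divide_distrib power_mult_distrib mult_ac)
    qed
    moreover have "(\<lambda>p. \<Sum>j\<in>UNIV. b j * ((D $ j $ j * z) ^ p / of_real (m p))) sums G z"
      unfolding G_def by (intro sums_sum sums_mult E)
    ultimately show ?thesis
      unfolding eval_fps_def by (simp add: sums_iff)
  qed
  have "\<forall>\<^sub>F z in nhds 0. y z $ h = G z"
    using F[of h] evalF unfolding has_fps_expansion_def by (auto elim: eventually_mono)
  then obtain S where S: "open S" "0 \<in> S" "\<And>z. z \<in> S \<Longrightarrow> y z $ h = G z"
    unfolding eventually_nhds by auto
  have "y z $ h = G z" for z
    by (rule analytic_continuation_open[of S UNIV "\<lambda>z. y z $ h" G])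
       (use S entire Ghol in auto)
  then show ?thesis unfolding G_def by blast
qed

section \<open>The indicator of a solution\<close>

text \<open>The eigenvalue \<open>0\<close> contributes the constant \<open>E 0\<close>, which any positive \<open>C\<close> dominates; this
  is why its share of the bound is \<open>0\<close>.\<close>

lemma kernel_sum_gen_indicator_le:
  fixes d b :: "'n::finite \<Rightarrow> complex"
  assumes npo: "nonzero_proximate_order rho \<rho>" and s: "0 < s"
    and f: "\<And>z. f z = (\<Sum>j\<in>UNIV. b j * E (d j * z))"
    and B: "\<And>j. (if d j = 0 then 0
                 else ereal (cmod (d j) powr \<rho>) * gen_indicator rho E (\<theta> + Arg (d j))) \<le> B"
  shows "gen_indicator (\<lambda>t. rho (s * t)) f \<theta> \<le> B"
proof (rule dense_ge)
  fix x assume x: "B < x"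
  note W = proximate_order_powr_at_top[OF npo s]
  obtain C where C: "B < ereal C" "ereal C < x" using ereal_dense2[OF x] by auto
  have each: "\<forall>\<^sub>F r in at_top. cmod (E (d j * rcis r \<theta>)) \<le> exp (C * r powr rho (s * r))" for j
  proof (cases "d j = 0")
    case True
    then have "0 < C" using le_less_trans[OF B[of j] C(1)] by simp
    then have "\<forall>\<^sub>F r in at_top. (cmod (E 0) + 1) * exp (0 * r powr rho (s * r))
                 \<le> exp (C * r powr rho (s * r))"
      by (intro eventually_const_mult_exp_le[OF W]) (auto simp: add_nonneg_pos)
    then show ?thesis by eventually_elim (simp add: True)
  next
    case False
    then show ?thesis
      using le_less_trans[OF B[of j] C(1)] by (intro rotated_scaled_exp_bound[OF npo s]) auto
  qed
  then have all: "\<forall>\<^sub>F r in at_top. \<forall>j. cmod (E (d j * rcis r \<theta>)) \<le> exp (C * r powr rho (s * r))"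
    by (rule eventually_all_finite)
  define K where "K = (\<Sum>j\<in>UNIV. cmod (b j)) + 1"
  have K: "0 < K" unfolding K_def by (simp add: add_nonneg_pos sum_nonneg)
  show "gen_indicator (\<lambda>t. rho (s * t)) f \<theta> \<le> x"
  proof (cases x)
    case (real C')
    have "\<forall>\<^sub>F r in at_top. K * exp (C * r powr rho (s * r)) \<le> exp (C' * r powr rho (s * r))"
      using C(2) real by (intro eventually_const_mult_exp_le[OF W _ K]) auto
    with all have "\<forall>\<^sub>F r in at_top. cmod (f (rcis r \<theta>)) \<le> exp (C' * r powr rho (s * r))"
    proof eventually_elim
      case (elim r)
      have "cmod (f (rcis r \<theta>)) \<le> (\<Sum>j\<in>UNIV. cmod (b j) * exp (C * r powr rho (s * r)))"
        unfolding f using elim(1)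
        by (intro order_trans[OF norm_sum] sum_mono) (simp add: norm_mult mult_left_mono)
      also have "\<dots> \<le> K * exp (C * r powr rho (s * r))"
        by (simp add: K_def sum_distrib_right[symmetric] distrib_right)
      finally show ?case using elim(2) by linarith
    qed
    then show ?thesis
      using exp_bound_imp_gen_indicator_le[of f \<theta> C' "\<lambda>t. rho (s * t)"] real by simp
  qed (use C in auto)
qed

theorem theorem7:
  fixes M :: "nat \<Rightarrow> real" and rho :: "real \<Rightarrow> real" and \<rho> :: real
    and e E :: "complex \<Rightarrow> complex"
    and A :: "complex^'n^'n" and y :: "complex \<Rightarrow> complex^'n"
    and z0 \<mu>0 :: complex and y0 :: "complex^'n" and h :: 'n and \<theta> :: real
  assumes "strongly_regular M"
    and "nonzero_proximate_order rho \<rho>"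
    and "admits_proximate_order M rho"
    and "kernel_pair M e E"
    and "diagonalizable A"
    and "moment_solution (moments e) A y"
    and entire: "\<And>i. (\<lambda>z. y z $ i) holomorphic_on UNIV"
    and "y z0 = y0"
    and "\<mu>0 \<in> spec A" and "\<And>\<mu>. \<mu> \<in> spec A \<Longrightarrow> cmod \<mu> \<le> cmod \<mu>0"
  shows "gen_indicator (if A = 0 then rho else (\<lambda>t. rho (cmod \<mu>0 * t))) (\<lambda>z. y z $ h) \<theta>
       \<le> Max ((\<lambda>\<mu>. if \<mu> = 0 then 0
                     else ereal (cmod \<mu> powr \<rho>) * gen_indicator rho E (\<theta> + Arg \<mu>)) ` spec A)"
    (is "_ \<le> Max (?g ` spec A)")
proof -
  have pos: "0 < moments e p" for p
    using assms(4) by (auto simp: kernel_pair_def Let_def)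
  have mf: "moment_fun e (of_nat p) = of_real (moments e p)" for p
    using assms(4) by (auto simp: kernel_pair_def Let_def moments_def complex_is_Real_iff complex_eq_iff)
  have "\<And>z. (\<lambda>p. z ^ p / moment_fun e (of_nat p)) sums E z"
    using assms(4) unfolding kernel_pair_def Let_def by blast
  then have Esums: "\<And>z. (\<lambda>p. z ^ p / of_real (moments e p)) sums E z" unfolding mf .
  have Ehol: "E holomorphic_on UNIV" using assms(4) unfolding kernel_pair_def Let_def by blast
  obtain P D :: "complex^'n^'n" where PD: "invertible P" "\<And>i j. i \<noteq> j \<Longrightarrow> D $ i $ j = 0"
      "A = P ** D ** matrix_inv P"
    using assms(5) unfolding diagonalizable_def by blast
  have specA: "spec A = range (\<lambda>j. D $ j $ j)" using spec_diagonalized[OF PD(1,2)] PD(3) by simp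
  obtain b where b: "\<And>z. y z $ h = (\<Sum>j\<in>UNIV. b j * E (D $ j $ j * z))"
    using diagonalizable_solution_kernel_sum[OF pos Esums Ehol PD assms(6) entire] by blast
  define s where "s = (if A = 0 then 1 else cmod \<mu>0)"
  have s: "0 < s"
  proof (rule ccontr)
    assume "\<not> 0 < s"
    then have "A \<noteq> 0" "\<mu>0 = 0" by (auto simp: s_def split: if_splits)
    then have "D $ j $ j = 0" for j using assms(10)[of "D $ j $ j"] specA by simp
    then have "D = 0" using PD(2) by (metis vec_eq_iff zero_index)
    then have "A = 0" using PD(3) by (simp add: matrix_matrix_mult_def vec_eq_iff)
    then show False using \<open>A \<noteq> 0\<close> by simp
  qed
  have "gen_indicator (\<lambda>t. rho (s * t)) (\<lambda>z. y z $ h) \<theta> \<le> Max (?g ` spec A)"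
  proof (rule kernel_sum_gen_indicator_le[OF assms(2) s b])
    show "?g (D $ j $ j) \<le> Max (?g ` spec A)" for j
      by (rule Max_ge) (auto simp: specA)
  qed
  moreover have "(\<lambda>t. rho (s * t)) = (if A = 0 then rho else (\<lambda>t. rho (cmod \<mu>0 * t)))"
    by (auto simp: s_def)
  ultimately show ?thesis by simp
qed

end
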